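(* Let $k\ge 1$ be an integer. The $k$-polymatroid Tutte polynomial $T_k$ is multiplicative on direct sums: if $P_1=(E_1,r_1)$ and $P_2=(E_2,r_2)$ are $k$-polymatroids with $E_1\cap E_2=\emptyset$, then $$T_k(P_1\oplus P_2;x,y)=T_k(P_1;x,y)\,T_k(P_2;x,y).$$
   Context: A polymatroid is a pair $P=(E,r)$ with $E$ a finite set and $r:2^E\to\mathbb{Z}$ such that $r(\emptyset)=0$, $r(A)\le r(B)$ whenever $A\subseteq B$, and $r(A)+r(B)\ge r(A\cup B)+r(A\cap B)$ for all $A,B\subseteq E$. It is a $k$-polymatroid if $r(\{e\})\le k$ for all $e\in E$. $k$-polymatroid Tutte polynomial: $T_k(P;x,y)=\sum_{A\subseteq E}(x-1)^{r(E)-r(A)}(y-1)^{k|A|-r(A)}$. Direct sum of $P_1,P_2$ with disjoint groundsets: $P_1\oplus P_2=(E_1\cup E_2,r)$ with $r(X)=r_1(X\cap E_1)+r_2(X\cap E_2)$. *)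

theory Defs
  imports "HOL-Computational_Algebra.Polynomial"
begin

(* The rank function is only constrained, and only used, on subsets of the ground set. *)
type_synonym 'a ranked_set = "'a set \<times> ('a set \<Rightarrow> int)"

definition polymatroid :: "'a ranked_set \<Rightarrow> bool" where
  "polymatroid P \<longleftrightarrow>
    (case P of (E, r) \<Rightarrow>
      finite E \<and>
      r {} = 0 \<and>
      (\<forall>A B. A \<subseteq> B \<and> B \<subseteq> E \<longrightarrow> r A \<le> r B) \<and>
      (\<forall>A B. A \<subseteq> E \<and> B \<subseteq> E \<longrightarrow> r A + r B \<ge> r (A \<union> B) + r (A \<inter> B)))"

definition k_polymatroid :: "nat \<Rightarrow> 'a ranked_set \<Rightarrow> bool" where
  "k_polymatroid k P \<longleftrightarrow>
    polymatroid P \<and> (case P of (E, r) \<Rightarrow> \<forall>e\<in>E. r {e} \<le> int k)"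

definition direct_sum :: "'a ranked_set \<Rightarrow> 'a ranked_set \<Rightarrow> 'a ranked_set" where
  "direct_sum P1 P2 =
    (case P1 of (E1, r1) \<Rightarrow> case P2 of (E2, r2) \<Rightarrow>
      (E1 \<union> E2, \<lambda>X. r1 (X \<inter> E1) + r2 (X \<inter> E2)))"

(* Z[x,y] is modelled as (Z[x])[y]: the coefficients of the outer polynomial in y
   are polynomials in x. *)
definition var_x :: "int poly poly" where
  "var_x = [:[:0, 1:]:]"

definition var_y :: "int poly poly" where
  "var_y = [:0, 1:]"

(* For k-polymatroids both exponents are nonnegative, so nat does not truncate:
   see k_polymatroid_exponents and k_polymatroid_direct_sum below. *)
definition tutte_poly :: "nat \<Rightarrow> 'a ranked_set \<Rightarrow> int poly poly" where
  "tutte_poly k P =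
    (case P of (E, r) \<Rightarrow>
      \<Sum>A\<in>Pow E. (var_x - 1) ^ nat (r E - r A) * (var_y - 1) ^ nat (int k * int (card A) - r A))"

lemma k_polymatroid_exponents:
  assumes "k_polymatroid k (E, r)" and "A \<subseteq> E"
  shows "r E - r A \<ge> 0" and "int k * int (card A) - r A \<ge> 0"
proof -
  have fin: "finite E" and r0: "r {} = 0"
    and mono: "\<And>A B. A \<subseteq> B \<Longrightarrow> B \<subseteq> E \<Longrightarrow> r A \<le> r B"
    and sub: "\<And>A B. A \<subseteq> E \<Longrightarrow> B \<subseteq> E \<Longrightarrow> r (A \<union> B) + r (A \<inter> B) \<le> r A + r B"
    and k: "\<And>e. e \<in> E \<Longrightarrow> r {e} \<le> int k"
    using assms(1) by (auto simp: k_polymatroid_def polymatroid_def)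
  show "r E - r A \<ge> 0" using mono[of A E] assms(2) by simp
  have "finite A" using fin assms(2) finite_subset by blast
  then have "r A \<le> int k * int (card A)" using assms(2)
  proof (induction A rule: finite_induct)
    case empty
    then show ?case using r0 by simp
  next
    case (insert e A)
    then have "r (insert e A) \<le> r {e} + r A"
      using sub[of "{e}" A] r0 by simp
    also have "\<dots> \<le> int k + int k * int (card A)"
      using insert k by (intro add_mono) auto
    finally show ?case using insert by (simp add: algebra_simps)
  qed
  then show "int k * int (card A) - r A \<ge> 0" by simp
qed

lemma k_polymatroid_direct_sum:
  assumes "k_polymatroid k (E1, r1)" and "k_polymatroid k (E2, r2)" and "E1 \<inter> E2 = {}"
  shows "k_polymatroid k (direct_sum (E1, r1) (E2, r2))"
proof -
  have p: "r1 {} = 0" "r2 {} = 0" "finite E1" "finite E2"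
    and k: "\<And>e. e \<in> E1 \<Longrightarrow> r1 {e} \<le> int k" "\<And>e. e \<in> E2 \<Longrightarrow> r2 {e} \<le> int k"
    and m1: "\<And>A B. A \<subseteq> B \<Longrightarrow> B \<subseteq> E1 \<Longrightarrow> r1 A \<le> r1 B"
    and m2: "\<And>A B. A \<subseteq> B \<Longrightarrow> B \<subseteq> E2 \<Longrightarrow> r2 A \<le> r2 B"
    and s1: "\<And>A B. A \<subseteq> E1 \<Longrightarrow> B \<subseteq> E1 \<Longrightarrow> r1 (A \<union> B) + r1 (A \<inter> B) \<le> r1 A + r1 B"
    and s2: "\<And>A B. A \<subseteq> E2 \<Longrightarrow> B \<subseteq> E2 \<Longrightarrow> r2 (A \<union> B) + r2 (A \<inter> B) \<le> r2 A + r2 B"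
    using assms(1,2) by (auto simp: k_polymatroid_def polymatroid_def)
  let ?r = "\<lambda>X. r1 (X \<inter> E1) + r2 (X \<inter> E2)"
  have "?r A \<le> ?r B" if "A \<subseteq> B" for A B
    using that by (intro add_mono m1 m2) auto
  moreover have "?r (A \<union> B) + ?r (A \<inter> B) \<le> ?r A + ?r B" for A B
  proof -
    have "(A \<union> B) \<inter> X = (A \<inter> X) \<union> (B \<inter> X)" "(A \<inter> B) \<inter> X = (A \<inter> X) \<inter> (B \<inter> X)" for X
      by auto
    then show ?thesis
      using s1[of "A \<inter> E1" "B \<inter> E1"] s2[of "A \<inter> E2" "B \<inter> E2"] by simp
  qed
  moreover have "?r {e} \<le> int k" if "e \<in> E1 \<union> E2" for e
  proof (cases "e \<in> E1")
    case True
    then have "{e} \<inter> E1 = {e}" "{e} \<inter> E2 = {}" using assms(3) by auto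
    then show ?thesis using True p k by simp
  next
    case False
    then have "{e} \<inter> E1 = {}" "{e} \<inter> E2 = {e}" "e \<in> E2" using that by auto
    then show ?thesis using p k by simp
  qed
  ultimately show ?thesis
    using p by (simp add: k_polymatroid_def polymatroid_def direct_sum_def)
qed

end

theory Submission
  imports Defs
begin

text \<open>A subset of \<open>E1 \<union> E2\<close> splits uniquely as
  \<open>A1 \<union> A2\<close> with \<open>A1 \<subseteq> E1\<close> and
  \<open>A2 \<subseteq> E2\<close>. Rank and cardinality are additive under this splitting, hence so
  are both exponents, and each term of the direct sum's polynomial is a product of one term from
  each factor. By \<open>sum_Pow_disjoint_Un\<close> the sum runs over pairs, so it is the product
  of the two sums.\<close>

lemma sum_Pow_disjoint_Un:
  assumes "E1 \<inter> E2 = {}"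
  shows "(\<Sum>A\<in>Pow (E1 \<union> E2). f A) = (\<Sum>(A1, A2)\<in>Pow E1 \<times> Pow E2. f (A1 \<union> A2))"
proof -
  have "bij_betw (\<lambda>(A1, A2). A1 \<union> A2) (Pow E1 \<times> Pow E2) (Pow (E1 \<union> E2))"
    by (rule bij_betw_byWitness[where f' = "\<lambda>A. (A \<inter> E1, A \<inter> E2)"]) (use assms in auto)
  then show ?thesis
    by (auto simp: sum.reindex_bij_betw[symmetric] intro!: sum.cong)
qed

theorem proposition3p4:
  fixes k :: nat
    and E1 E2 :: "'a set"
    and r1 r2 :: "'a set \<Rightarrow> int"
  assumes "k \<ge> 1"
    and "k_polymatroid k (E1, r1)"
    and "k_polymatroid k (E2, r2)"
    and "E1 \<inter> E2 = {}"
  shows "tutte_poly k (direct_sum (E1, r1) (E2, r2)) =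
         tutte_poly k (E1, r1) * tutte_poly k (E2, r2)"
proof -
  define r where "r X = r1 (X \<inter> E1) + r2 (X \<inter> E2)" for X
  \<comment> \<open>Ground set and rank function are parameters, so that one summand serves the
    direct sum and both factors.\<close>
  define t :: "'a set \<Rightarrow> ('a set \<Rightarrow> int) \<Rightarrow> 'a set \<Rightarrow> int poly poly"
    where "t E s A = (var_x - 1) ^ nat (s E - s A) *
      (var_y - 1) ^ nat (int k * int (card A) - s A)" for E s A
  have fin: "finite E1" "finite E2"
    using assms by (auto simp: k_polymatroid_def polymatroid_def)
  have t_Un: "t (E1 \<union> E2) r (A1 \<union> A2) = t E1 r1 A1 * t E2 r2 A2"
    if "A1 \<subseteq> E1" "A2 \<subseteq> E2" for A1 A2
  proof -
    have "(A1 \<union> A2) \<inter> E1 = A1" "(A1 \<union> A2) \<inter> E2 = A2"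
      "(E1 \<union> E2) \<inter> E1 = E1" "(E1 \<union> E2) \<inter> E2 = E2" "A1 \<inter> A2 = {}"
      using that assms(4) by auto
    moreover from this have "card (A1 \<union> A2) = card A1 + card A2"
      using that fin by (simp add: card_Un_disjoint finite_subset)
    ultimately have
      "r (E1 \<union> E2) - r (A1 \<union> A2) = (r1 E1 - r1 A1) + (r2 E2 - r2 A2)"
      "int k * int (card (A1 \<union> A2)) - r (A1 \<union> A2) =
        (int k * int (card A1) - r1 A1) + (int k * int (card A2) - r2 A2)"
      by (simp_all add: r_def algebra_simps)
    \<comment> \<open>Additivity so far holds over the integers. It passes through
      \<open>nat\<close> because \<open>k_polymatroid_exponents\<close> makes each of the four
      exponents nonnegative, as \<open>nat_add_distrib\<close> requires.\<close>
    then show ?thesis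
      using k_polymatroid_exponents[OF assms(2) that(1)]
        k_polymatroid_exponents[OF assms(3) that(2)]
      by (simp only: t_def nat_add_distrib power_add mult_ac)
  qed
  have "tutte_poly k (direct_sum (E1, r1) (E2, r2)) = (\<Sum>A\<in>Pow (E1 \<union> E2). t (E1 \<union> E2) r A)"
    by (simp add: tutte_poly_def direct_sum_def t_def r_def)
  also have "\<dots> = (\<Sum>(A1, A2)\<in>Pow E1 \<times> Pow E2. t E1 r1 A1 * t E2 r2 A2)"
    unfolding sum_Pow_disjoint_Un[OF assms(4)] by (rule sum.cong) (auto simp: t_Un)
  also have "\<dots> = tutte_poly k (E1, r1) * tutte_poly k (E2, r2)"
    by (simp add: tutte_poly_def t_def sum_product sum.cartesian_product)
  finally show ?thesis .
qed

end
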